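(* Let $n,k$ be positive integers with $n\ge k$ and let $\tau$ be any positional marked pattern of length $k$. Then the polynomial $P_{n,\tau}(x)=\sum_{\sigma\in S_n}x^{pmp_\tau(\sigma)}$ has degree $n-k+1$, and its coefficient of $x^{n-k+1}$ equals $(n-k+1)!$.
   Context: A positional marked pattern of length $k$ is a permutation $\tau=\tau_1\cdots\tau_k$ of $[k]$ with exactly one entry underlined; $\pi(\tau)\in S_k$ is the permutation obtained by removing the underline and $u(\tau)$ is the position of the underlined entry. For a word $w$ with distinct letters, $red(w)$ replaces the $i$-th smallest letter by $i$. For $\sigma\in S_n$, $\sigma$ has a $\tau$-match at position $\ell$ if there are indices $i_1<\cdots<i_k$ with $i_{u(\tau)}=\ell$ and $red(\sigma_{i_1}\cdots\sigma_{i_k})=\pi(\tau)$; $pmp_\tau(\sigma)$ is the number of positions $\ell$ at which $\sigma$ has a $\tau$-match. *)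

theory Defs
  imports
    "HOL-Combinatorics.Multiset_Permutations"
    "HOL-Computational_Algebra.Polynomial"
begin

text \<open>
  Permutations are written in one-line notation, as words (lists) over the letters
  \<open>1, \<dots>, n\<close>. Positions in words are counted from 1, whereas list indexing starts at 0.
\<close>

abbreviation Sym :: "nat \<Rightarrow> nat list set" where
  "Sym n \<equiv> permutations_of_set {1..n}"

definition letter :: "'a list \<Rightarrow> nat \<Rightarrow> 'a" where
  "letter w i = w ! (i - 1)"

text \<open>If the letters of \<open>w\<close> are distinct, the \<open>i\<close>-th smallest one has exactly \<open>i\<close> letters below or equal to it.\<close>

definition red :: "nat list \<Rightarrow> nat list" where
  "red w = map (\<lambda>x. card {y \<in> set w. y \<le> x}) w"

text \<open>The pair consists of the permutation without the underline and the underlined position.\<close>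

type_synonym marked_pattern = "nat list \<times> nat"

abbreviation pat :: "marked_pattern \<Rightarrow> nat list" where
  "pat \<tau> \<equiv> fst \<tau>"

abbreviation upos :: "marked_pattern \<Rightarrow> nat" where
  "upos \<tau> \<equiv> snd \<tau>"

definition is_marked_pattern :: "nat \<Rightarrow> marked_pattern \<Rightarrow> bool" where
  "is_marked_pattern k \<tau> \<longleftrightarrow> pat \<tau> \<in> Sym k \<and> upos \<tau> \<in> {1..k}"

text \<open>The list \<open>is\<close> is the sequence of indices \<open>i\<^sub>1 < \<dots> < i\<^sub>k\<close>.\<close>

definition match_at :: "marked_pattern \<Rightarrow> nat list \<Rightarrow> nat \<Rightarrow> bool" where
  "match_at \<tau> \<sigma> l \<longleftrightarrow>
     (\<exists>is. length is = length (pat \<tau>) \<and> sorted_wrt (<) is \<and> set is \<subseteq> {1..length \<sigma>} \<and>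
           letter is (upos \<tau>) = l \<and> red (map (letter \<sigma>) is) = pat \<tau>)"

definition pmp :: "marked_pattern \<Rightarrow> nat list \<Rightarrow> nat" where
  "pmp \<tau> \<sigma> = card {l \<in> {1..length \<sigma>}. match_at \<tau> \<sigma> l}"

definition P :: "nat \<Rightarrow> marked_pattern \<Rightarrow> int poly" where
  "P n \<tau> = (\<Sum>\<sigma>\<in>Sym n. monom 1 (pmp \<tau> \<sigma>))"

end

theory Submission
  imports Defs
begin

text \<open>
  Let \<open>u\<close> be the underlined position of the pattern, \<open>h\<close> the underlined letter and \<open>d = n - k\<close>.
  A match needs \<open>u - 1\<close> positions to its left and \<open>k - u\<close> to its right, so there are at most
  \<open>d + 1\<close> match positions, the block \<open>u, \<dots>, u + d\<close>; likewise the matched letters lie in the block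
  \<open>h, \<dots>, h + d\<close>.  If all \<open>d + 1\<close> positions match, the middle positions carry exactly the
  middle letters.  The matches at positions \<open>u\<close> and \<open>u + d\<close> then tell which outer positions carry
  small and which carry large letters, and the matches at the letters \<open>h\<close> and \<open>h + d\<close> determine the
  relative order of the small and of the large letters.  So everything outside the middle block is
  forced to be the pattern stretched by \<open>d\<close>, while the \<open>d + 1\<close> middle letters are in
  arbitrary order.
\<close>

section \<open>Increasing maps between initial segments\<close>

lemma strict_mono_on_gap:
  fixes f :: "nat \<Rightarrow> nat"
  assumes "strict_mono_on {..<k} f" "i \<le> j" "j < k"
  shows "f i + (j - i) \<le> f j"
  using assms(2,3)
proof (induction j rule: dec_induct)
  case (step j)
  have "f j < f (Suc j)"
    using strict_mono_onD[OF assms(1)] step by simp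
  with step show ?case by simp
qed simp

text \<open>The \<open>i\<close> values below \<open>f i\<close> and the \<open>k - 1 - i\<close>
  values above it need room, which leaves \<open>n - k + 1\<close> choices for
  \<open>f i\<close>.\<close>

lemma strict_mono_on_between:
  fixes f :: "nat \<Rightarrow> nat"
  assumes "strict_mono_on {..<k} f" "f ` {..<k} \<subseteq> {..<n}" "i < k"
  shows "i \<le> f i" "f i \<le> i + (n - k)"
proof -
  show "i \<le> f i"
    using strict_mono_on_gap[OF assms(1), of 0 i] assms(3) by simp
  have "f i + (k - 1 - i) \<le> f (k - 1)"
    using strict_mono_on_gap[OF assms(1), of i "k - 1"] assms(3) by simp
  moreover have "f (k - 1) < n" using assms(2,3) by (auto simp: image_subset_iff)
  ultimately show "f i \<le> i + (n - k)" using assms(3) by linarith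
qed

text \<open>The value at \<open>i\<close> is squeezed: it is at least \<open>i\<close>, and at least
  \<open>u - i\<close> below \<open>f u = u\<close>.\<close>

lemma strict_mono_on_lowest:
  fixes f :: "nat \<Rightarrow> nat"
  assumes "strict_mono_on {..<k} f" "f ` {..<k} \<subseteq> {..<n}" "u < k" "f u = u" "i \<le> u"
  shows "f i = i"
  using strict_mono_on_gap[OF assms(1), of i u] strict_mono_on_between[OF assms(1,2), of i] assms
  by simp

lemma strict_mono_on_highest:
  fixes f :: "nat \<Rightarrow> nat"
  assumes "strict_mono_on {..<k} f" "f ` {..<k} \<subseteq> {..<n}" "f u = u + (n - k)" "u \<le> i" "i < k"
  shows "f i = i + (n - k)"
  using strict_mono_on_gap[OF assms(1), of u i] strict_mono_on_between[OF assms(1,2), of i] assms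
  by simp

text \<open>On a finite set the map is also onto. If all smaller elements are fixed,
  \<open>f i < i\<close> contradicts injectivity; and if \<open>i < f i\<close>, then
  \<open>i\<close> has no preimage, since smaller elements are fixed and the others have values at
  least \<open>f i\<close>.\<close>

lemma strict_mono_on_finite_self_map_id:
  fixes f :: "nat \<Rightarrow> nat"
  assumes "strict_mono_on L f" "f ` L \<subseteq> L" "finite L" "i \<in> L"
  shows "f i = i"
  using assms(4)
proof (induction i rule: less_induct)
  case (less i)
  have inj: "inj_on f L" using assms(1) by (rule strict_mono_on_imp_inj_on)
  have "\<not> f i < i"
    using less inj assms(2) by (metis image_subset_iff inj_onD less_irrefl)
  moreover have "\<not> i < f i"
  proof
    assume "i < f i"
    obtain j where j: "j \<in> L" "f j = i"
      using endo_inj_surj[OF assms(3,2) inj] less.prems by (metis imageE)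
    show False
    proof (cases "j < i")
      case True
      with less.IH j show False by simp
    next
      case False
      then have "f i \<le> f j"
        using strict_mono_onD[OF assms(1), of i j] less.prems j by (cases "i = j") auto
      with \<open>i < f i\<close> j show False by simp
    qed
  qed
  ultimately show ?case by simp
qed

text \<open>
  A match of the pattern \<open>t\<close> in the permutation \<open>s\<close> (both counted from 0) is a commuting square of
  increasing maps, \<open>f\<close> on positions and \<open>g\<close> on letters; the two play symmetric roles.
\<close>

definition square_match ::
  "nat \<Rightarrow> nat \<Rightarrow> (nat \<Rightarrow> nat) \<Rightarrow> nat \<Rightarrow> (nat \<Rightarrow> nat) \<Rightarrow> nat \<Rightarrow> (nat \<Rightarrow> nat) \<Rightarrow> (nat \<Rightarrow> nat) \<Rightarrow> bool" where
  "square_match n k t u s l f g \<longleftrightarrow>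
     strict_mono_on {..<k} f \<and> f ` {..<k} \<subseteq> {..<n} \<and>
     strict_mono_on {..<k} g \<and> g ` {..<k} \<subseteq> {..<n} \<and>
     f u = l \<and> (\<forall>i<k. s (f i) = g (t i))"

text \<open>The increasing map that leaves the gap \<open>{u..u + d}\<close> when restricted to
  indices other than \<open>u\<close>. At \<open>u\<close> it has the default value
  \<open>u + d\<close>, which its uses exclude or overwrite.\<close>

definition stretch :: "nat \<Rightarrow> nat \<Rightarrow> nat \<Rightarrow> nat" where
  "stretch d u i = (if i < u then i else i + d)"

section \<open>Bounds on a match, and matches built from stretches\<close>

locale pattern_in_permutation =
  fixes n k u :: nat and t s :: "nat \<Rightarrow> nat"
  assumes k_le_n: "k \<le> n" and u_less: "u < k"
    and bij_t: "bij_betw t {..<k} {..<k}" and bij_s: "bij_betw s {..<n} {..<n}"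
begin

abbreviation d where "d \<equiv> n - k"
abbreviation h where "h \<equiv> t u"

lemma h_less: "h < k"
  using bij_betwE[OF bij_t] u_less by simp

lemma t_less: "i < k \<Longrightarrow> t i < k"
  using bij_betwE[OF bij_t] by simp

lemma t_eq_h_iff: "i < k \<Longrightarrow> t i = h \<longleftrightarrow> i = u"
  using bij_betw_imp_inj_on[OF bij_t] u_less by (auto dest: inj_onD)

text \<open>The bound on letters is the bound on positions applied to \<open>g\<close>, since
  \<open>s l = s (f u) = g h\<close>.\<close>

lemma square_match_bounds:
  assumes "square_match n k t u s l f g"
  shows "l \<in> {u..u + d}" "s l \<in> {h..h + d}"
  using assms strict_mono_on_between[of k f n u] strict_mono_on_between[of k g n h] u_less h_less
  unfolding square_match_def by auto

text \<open>Both maps of the square are stretches, redirected at the marked index to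
  \<open>l\<close> and to \<open>s l\<close>. They stay increasing because these values lie in the
  gaps.\<close>

lemma square_match_if_stretched:
  assumes "l \<in> {u..u + d}" "s l \<in> {h..h + d}"
    and "\<And>i. i < k \<Longrightarrow> i \<noteq> u \<Longrightarrow> s (stretch d u i) = stretch d h (t i)"
  shows "\<exists>f g. square_match n k t u s l f g"
proof (intro exI)
  show "square_match n k t u s l ((stretch d u)(u := l)) ((stretch d h)(h := s l))"
    unfolding square_match_def
  proof (intro conjI allI impI)
    fix i assume i: "i < k"
    show "s (((stretch d u)(u := l)) i) = ((stretch d h)(h := s l)) (t i)"
      using assms(3)[OF i] t_eq_h_iff[OF i] by auto
  qed (use assms(1,2) u_less h_less k_le_n in
        \<open>auto simp: stretch_def strict_mono_on_def split: if_splits\<close>)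
qed

section \<open>The extremal case: every position of the middle block matches\<close>

context
  assumes all_match: "\<And>l. l \<in> {u..u + d} \<Longrightarrow> \<exists>f g. square_match n k t u s l f g"
begin

text \<open>The bounds on matched letters give one inclusion; \<open>s\<close> is injective and both
  blocks have \<open>d + 1\<close> elements.\<close>

lemma middle_image: "s ` {u..u + d} = {h..h + d}"
proof (rule card_subset_eq)
  show "s ` {u..u + d} \<subseteq> {h..h + d}"
    using all_match square_match_bounds(2) by blast
  have "{u..u + d} \<subseteq> {..<n}" using u_less k_le_n by auto
  then have "inj_on s {u..u + d}"
    using bij_betw_imp_inj_on[OF bij_s] inj_on_subset by blast
  then show "card (s ` {u..u + d}) = card {h..h + d}"
    by (simp add: card_image)
qed simp

lemma middle_iff:
  assumes "j < n" shows "s j \<in> {h..h + d} \<longleftrightarrow> j \<in> {u..u + d}"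
proof
  assume "s j \<in> {h..h + d}"
  then obtain j' where "j' \<in> {u..u + d}" "s j' = s j"
    using middle_image by (metis imageE)
  moreover have "j' < n" using \<open>j' \<in> {u..u + d}\<close> u_less k_le_n by auto
  ultimately show "j \<in> {u..u + d}"
    using bij_betw_imp_inj_on[OF bij_s] assms by (metis inj_onD lessThan_iff)
qed (use middle_image in blast)

text \<open>In a suitable match \<open>i\<close> sits at \<open>stretch d u i\<close>. Its letter
  \<open>g (t i)\<close> compares with \<open>g h\<close> as \<open>t i\<close> does with
  \<open>h\<close>; as \<open>g h\<close> is a middle letter and \<open>g (t i)\<close> is not, the
  comparison extends to the whole block.\<close>

lemma outer_small_large:
  assumes i: "i < k" "i \<noteq> u"
  shows "s (stretch d u i) < h \<longleftrightarrow> t i < h" "h + d < s (stretch d u i) \<longleftrightarrow> h < t i"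
proof -
  \<comment> \<open>Marking the end of the block nearest to \<open>i\<close> leaves \<open>f\<close>
    no freedom on that side of \<open>u\<close>, so \<open>f i\<close> is known.\<close>
  define l where "l = (if i < u then u else u + d)"
  obtain f g where m: "square_match n k t u s l f g"
    using all_match[of l] by (cases "i < u") (auto simp: l_def)
  have fi: "f i = stretch d u i"
    using m i u_less strict_mono_on_lowest[of k f n u i] strict_mono_on_highest[of k f n u i]
    by (cases "i < u") (auto simp: square_match_def l_def stretch_def)
  have lt: "stretch d u i < n" using i k_le_n by (auto simp: stretch_def)
  have "s (stretch d u i) \<notin> {h..h + d}"
    using middle_iff[OF lt] i by (auto simp: stretch_def)
  moreover have "s (stretch d u i) = g (t i)" "g h = s l"
    using m i u_less fi by (auto simp: square_match_def)
  moreover have "s l \<in> {h..h + d}" using square_match_bounds[OF m] by simp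
  moreover have "t i < h \<Longrightarrow> g (t i) < g h" "h < t i \<Longrightarrow> g h < g (t i)"
    using m t_less[OF i(1)] h_less by (auto simp: square_match_def strict_mono_on_def)
  moreover have "t i \<noteq> h" using t_eq_h_iff i by simp
  ultimately have
    "t i < h \<and> s (stretch d u i) < h \<or> h < t i \<and> h + d < s (stretch d u i)"
    unfolding atLeastAtMost_iff by linarith
  then show "s (stretch d u i) < h \<longleftrightarrow> t i < h" "h + d < s (stretch d u i) \<longleftrightarrow> h < t i"
    by auto
qed

text \<open>Composing \<open>f\<close> with the inverse of the stretch gives an increasing map of
  the finite set \<open>L\<close> into itself, hence the identity. In the applications
  \<open>L\<close> consists of the indices of the small, or of the large, pattern letters.\<close>

lemma outer_positions_forced:
  assumes m: "square_match n k t u s l f g"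
    and L: "L \<subseteq> {..<k} - {u}"
    and outer: "\<And>i. i \<in> L \<Longrightarrow> f i \<notin> {u..u + d}"
    and closed: "\<And>i j. i \<in> L \<Longrightarrow> j < k \<Longrightarrow> j \<noteq> u \<Longrightarrow> stretch d u j = f i \<Longrightarrow> j \<in> L"
    and i: "i \<in> L"
  shows "f i = stretch d u i"
proof -
  \<comment> \<open>\<open>F\<close> closes the gap: it inverts the stretch at values outside the
    middle block.\<close>
  define F where "F i = (if f i < u then f i else f i - d)" for i
  have l: "l \<in> {u..u + d}" using square_match_bounds[OF m] by simp
  have mono: "f i < f j" if "i < j" "j < k" for i j
    using m that by (auto simp: square_match_def strict_mono_on_def)
  have fu: "f u = l" and fn: "\<And>i. i < k \<Longrightarrow> f i < n"
    using m by (auto simp: square_match_def)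
  have side: "stretch d u (F i) = f i \<and> F i < k \<and> F i \<noteq> u" if "i \<in> L" for i
    using outer[OF that] fn[of i] that L u_less k_le_n by (auto simp: F_def stretch_def)
  have "F ` L \<subseteq> L" using side closed by blast
  moreover have "strict_mono_on L F"
  proof (rule strict_mono_onI)
    fix i j assume ij: "i \<in> L" "j \<in> L" "i < j"
    then have "f i < f j" using mono L by auto
    \<comment> \<open>Values beyond the block exceed \<open>u + d\<close>, so after subtracting
      \<open>d\<close> they still exceed every value below \<open>u\<close>.\<close>
    then show "F i < F j"
      using outer[of i] outer[of j] ij by (auto simp: F_def)
  qed
  moreover have "finite L" using L finite_subset by blast
  ultimately have "F i = i" using i strict_mono_on_finite_self_map_id by blast
  with side[OF i] show ?thesis by simp
qed

text \<open>A match whose marked letter is \<open>h\<close> has \<open>g\<close> fix all letters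
  below \<open>h\<close>, so it shows the actual small letters; it remains to see where
  \<open>f\<close> puts them. Large letters are treated in the same way with the marked letter
  \<open>h + d\<close>.\<close>

lemma outer_forced:
  assumes i: "i < k" "i \<noteq> u"
  shows "s (stretch d u i) = stretch d h (t i)"
proof -
  \<comment> \<open>Each middle letter occurs in the middle block of positions, all of which match,
    so the marked letter can be prescribed.\<close>
  have ex: "\<exists>l f g. square_match n k t u s l f g \<and> s l = v" if "v \<in> {h..h + d}" for v
    using that all_match middle_image by (metis imageE)
  consider "t i < h" | "h < t i" using t_eq_h_iff i by (meson linorder_neqE_nat)
  then show ?thesis
  proof cases
    case 1
    obtain l f g where m: "square_match n k t u s l f g" and "s l = h"
      using ex[of h] by auto
    then have "g h = h" using u_less by (auto simp: square_match_def)
    then have low: "s (f j) = t j" if "j < k" "t j < h" for j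
      using strict_mono_on_lowest[of k g n h "t j"] m that h_less
      by (auto simp: square_match_def)
    have fn: "f j < n" if "j < k" for j using m that by (auto simp: square_match_def)
    \<comment> \<open>The positions \<open>f j\<close> carry small letters, so they avoid the middle
      block; an outer position with a small letter comes from an index with a small pattern letter,
      so the index set is closed.\<close>
    have "f i = stretch d u i"
    proof (rule outer_positions_forced[OF m, of "{j. j < k \<and> t j < h}"])
      fix j assume "j \<in> {j. j < k \<and> t j < h}"
      then show "f j \<notin> {u..u + d}" using low[of j] middle_iff[OF fn, of j] by auto
    next
      fix j j'
      assume "j \<in> {j. j < k \<and> t j < h}" "j' < k" "j' \<noteq> u" "stretch d u j' = f j"
      then show "j' \<in> {j. j < k \<and> t j < h}"
        using low[of j] outer_small_large(1)[of j'] by simp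
    qed (use i 1 in auto)
    then show ?thesis using low[of i] i 1 by (simp add: stretch_def)
  next
    case 2
    obtain l f g where m: "square_match n k t u s l f g" and "s l = h + d"
      using ex[of "h + d"] by auto
    then have "g h = h + d" using u_less by (auto simp: square_match_def)
    then have high: "s (f j) = t j + d" if "j < k" "h < t j" for j
      using strict_mono_on_highest[of k g n h "t j"] m that t_less[of j]
      by (auto simp: square_match_def)
    have fn: "f j < n" if "j < k" for j using m that by (auto simp: square_match_def)
    have "f i = stretch d u i"
    proof (rule outer_positions_forced[OF m, of "{j. j < k \<and> h < t j}"])
      fix j assume "j \<in> {j. j < k \<and> h < t j}"
      then show "f j \<notin> {u..u + d}" using high[of j] middle_iff[OF fn, of j] by auto
    next
      fix j j'
      assume "j \<in> {j. j < k \<and> h < t j}" "j' < k" "j' \<noteq> u" "stretch d u j' = f j"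
      then show "j' \<in> {j. j < k \<and> h < t j}"
        using high[of j] outer_small_large(2)[of j'] by simp
    qed (use i 2 in auto)
    then show ?thesis using high[of i] i 2 by (simp add: stretch_def)
  qed
qed

end

text \<open>This turns extremality into a condition that can be counted: the outer letters are
  prescribed and the middle ones only permuted among themselves.\<close>

lemma all_match_iff:
  "(\<forall>l\<in>{u..u + d}. \<exists>f g. square_match n k t u s l f g) \<longleftrightarrow>
     s ` {u..u + d} = {h..h + d} \<and> (\<forall>i<k. i \<noteq> u \<longrightarrow> s (stretch d u i) = stretch d h (t i))"
proof (intro iffI conjI allI impI)
  assume R: "s ` {u..u + d} = {h..h + d} \<and>
    (\<forall>i<k. i \<noteq> u \<longrightarrow> s (stretch d u i) = stretch d h (t i))"
  show "\<forall>l\<in>{u..u + d}. \<exists>f g. square_match n k t u s l f g"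
  proof
    fix l assume "l \<in> {u..u + d}"
    moreover from this R have "s l \<in> {h..h + d}" by blast
    ultimately show "\<exists>f g. square_match n k t u s l f g"
      using R square_match_if_stretched by blast
  qed
qed (use middle_image outer_forced in blast)+

end

section \<open>From words and reduction to commuting squares\<close>

text \<open>Reduction replaces a letter by its rank, and a larger letter has a strictly larger set
  of letters at or below it.\<close>

lemma red_order_iso:
  assumes "red w = p" "i < length w" "j < length w"
  shows "w ! i < w ! j \<longleftrightarrow> p ! i < p ! j"
proof -
  have p: "p ! i = card {y \<in> set w. y \<le> w ! i}" if "i < length w" for i
    using that assms(1) by (auto simp: red_def)
  show ?thesis
  proof (cases "w ! i < w ! j")
    case True
    have "w ! j \<in> {y \<in> set w. y \<le> w ! j}" "w ! j \<notin> {y \<in> set w. y \<le> w ! i}"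
      using True assms(3) by auto
    moreover have "{y \<in> set w. y \<le> w ! i} \<subseteq> {y \<in> set w. y \<le> w ! j}"
      using True by auto
    ultimately have "{y \<in> set w. y \<le> w ! i} \<subset> {y \<in> set w. y \<le> w ! j}" by blast
    then have "card {y \<in> set w. y \<le> w ! i} < card {y \<in> set w. y \<le> w ! j}"
      by (intro psubset_card_mono) auto
    with True show ?thesis using p assms by simp
  next
    case False
    then have "card {y \<in> set w. y \<le> w ! j} \<le> card {y \<in> set w. y \<le> w ! i}"
      by (intro card_mono) auto
    with False show ?thesis using p assms by simp
  qed
qed

lemma Sym_length: "p \<in> Sym k \<Longrightarrow> length p = k"
  by (simp add: permutations_of_set_def distinct_card[symmetric])

text \<open>The letters at most \<open>w ! i\<close> and those at most \<open>p ! i\<close> occupy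
  the same indices. Since \<open>p\<close> has letters \<open>1\<close> to \<open>k\<close>, exactly
  \<open>p ! i\<close> of them are at most \<open>p ! i\<close>.\<close>

lemma red_eqI:
  assumes p: "p \<in> Sym k" and len: "length w = k"
    and iso: "\<And>i j. i < k \<Longrightarrow> j < k \<Longrightarrow> w ! i < w ! j \<longleftrightarrow> p ! i < p ! j"
  shows "red w = p"
proof (rule nth_equalityI)
  have lp: "length p = k" and sp: "set p = {1..k}" and dp: "distinct p"
    using p Sym_length by (auto simp: permutations_of_set_def)
  show "length (red w) = length p" using len lp by (simp add: red_def)
  fix i assume "i < length (red w)"
  then have i: "i < k" using len by (simp add: red_def)
  have le: "w ! a \<le> w ! b \<longleftrightarrow> p ! a \<le> p ! b" if "a < k" "b < k" for a b
    using iso[of b a] that by (simp add: not_less[symmetric])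
  have inj: "inj_on ((!) w) {..<k}" "inj_on ((!) p) {..<k}"
  proof -
    show "inj_on ((!) p) {..<k}" using dp lp by (auto simp: inj_on_def nth_eq_iff_index_eq)
    \<comment> \<open>Equal letters of \<open>w\<close> are at most each other, so \<open>le\<close>
      makes the corresponding letters of \<open>p\<close> equal.\<close>
    then show "inj_on ((!) w) {..<k}" using le by (auto simp: inj_on_def order_eq_iff)
  qed
  have w: "{y \<in> set w. y \<le> w ! i} = (!) w ` {j \<in> {..<k}. p ! j \<le> p ! i}"
    using len le i by (force simp: in_set_conv_nth)
  have "{1..p ! i} = (!) p ` {j \<in> {..<k}. p ! j \<le> p ! i}"
  proof -
    have "p ! i \<le> k" using i lp sp nth_mem by fastforce
    then have "{1..p ! i} = {y \<in> set p. y \<le> p ! i}" using sp by auto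
    also have "\<dots> = (!) p ` {j \<in> {..<k}. p ! j \<le> p ! i}"
      using lp by (force simp: in_set_conv_nth)
    finally show ?thesis .
  qed
  then have "p ! i = card ((!) p ` {j \<in> {..<k}. p ! j \<le> p ! i})"
    by (metis card_atLeastAtMost diff_Suc_1 One_nat_def)
  also have "\<dots> = card ((!) w ` {j \<in> {..<k}. p ! j \<le> p ! i})"
  proof -
    have "{j \<in> {..<k}. p ! j \<le> p ! i} \<subseteq> {..<k}" by blast
    from inj_on_subset[OF inj(1) this] inj_on_subset[OF inj(2) this] show ?thesis
      by (simp only: card_image)
  qed
  finally show "red w ! i = p ! i" using w i len by (simp add: red_def)
qed

definition zero_based :: "nat list \<Rightarrow> nat \<Rightarrow> nat" where
  "zero_based p i = p ! i - 1"

lemma Sym_nth: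
  assumes "p \<in> Sym k" "i < k"
  shows "p ! i = Suc (zero_based p i)" "zero_based p i < k"
proof -
  have "p ! i \<in> {1..k}"
    using assms Sym_length[OF assms(1)] nth_mem[of i p] by (simp add: permutations_of_set_def)
  then show "p ! i = Suc (zero_based p i)" "zero_based p i < k"
    by (auto simp: zero_based_def)
qed

lemma Sym_bij_betw: "p \<in> Sym k \<Longrightarrow> bij_betw (zero_based p) {..<k} {..<k}"
proof -
  assume p: "p \<in> Sym k"
  have "inj_on (zero_based p) {..<k}"
  proof (rule inj_onI)
    fix i j assume "i \<in> {..<k}" "j \<in> {..<k}" "zero_based p i = zero_based p j"
    then have "p ! i = p ! j" using Sym_nth(1)[OF p] by simp
    then show "i = j"
      using p Sym_length[OF p] \<open>i \<in> {..<k}\<close> \<open>j \<in> {..<k}\<close>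
      by (simp add: permutations_of_set_def nth_eq_iff_index_eq)
  qed
  moreover have "zero_based p ` {..<k} \<subseteq> {..<k}" using Sym_nth(2)[OF p] by auto
  ultimately show ?thesis
    by (simp add: bij_betw_def endo_inj_surj)
qed

text \<open>The map \<open>f\<close> lists the chosen indices and \<open>g\<close> the chosen
  letters in increasing order. Being order isomorphic to the pattern amounts to \<open>g\<close>
  being increasing. Each \<open>Suc\<close> passes from counting from 0 to counting from 1.\<close>

lemma match_at_iff_square_match:
  assumes p: "p \<in> Sym k" and u: "u < k" and \<sigma>: "\<sigma> \<in> Sym n"
  shows "match_at (p, Suc u) \<sigma> (Suc l) \<longleftrightarrow>
         (\<exists>f g. square_match n k (zero_based p) u (zero_based \<sigma>) l f g)"
proof
  have lp: "length p = k" and l\<sigma>: "length \<sigma> = n" using p \<sigma> Sym_length by auto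
  note bij = Sym_bij_betw[OF p]
  {
    assume "match_at (p, Suc u) \<sigma> (Suc l)"
    then obtain js where js: "length js = k" "sorted_wrt (<) js" "set js \<subseteq> {1..n}"
        "js ! u = Suc l" "red (map (letter \<sigma>) js) = p"
      by (auto simp: match_at_def letter_def lp l\<sigma>)
    define f where "f i = js ! i - 1" for i
    have fS: "js ! i = Suc (f i)" "f i < n" if "i < k" for i
    proof -
      have "js ! i \<in> {1..n}" using js(1,3) that nth_mem by blast
      then show "js ! i = Suc (f i)" "f i < n" by (auto simp: f_def)
    qed
    \<comment> \<open>As \<open>q v\<close> is the index of the letter \<open>v\<close> in the
      pattern, the letter of \<sigma> at \<open>f (q v)\<close> plays the role of
      \<open>v\<close>.\<close>
    define q where "q = the_inv_into {..<k} (zero_based p)"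
    have q: "q v < k" "zero_based p (q v) = v" if "v < k" for v
      using that bij the_inv_into_into[of "zero_based p" "{..<k}" v "{..<k}"]
        f_the_inv_into_f_bij_betw[OF bij, of v]
      by (auto simp: q_def bij_betw_def)
    have qp: "q (zero_based p i) = i" if "i < k" for i
      using that bij by (simp add: q_def the_inv_into_f_f bij_betw_def)
    have iso: "zero_based \<sigma> (f i) < zero_based \<sigma> (f j) \<longleftrightarrow> zero_based p i < zero_based p j"
      if "i < k" "j < k" for i j
      using red_order_iso[OF js(5), of i j] that js(1) fS Sym_nth(1)[OF p] Sym_nth(1)[OF \<sigma>]
      by (simp add: letter_def)
    have "square_match n k (zero_based p) u (zero_based \<sigma>) l f (\<lambda>v. zero_based \<sigma> (f (q v)))"
      unfolding square_match_def
    proof (intro conjI allI impI)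
      show "strict_mono_on {..<k} f"
      proof (rule strict_mono_onI)
        fix i j assume "i \<in> {..<k}" "j \<in> {..<k}" "i < j"
        then show "f i < f j"
          using fS(1) sorted_wrt_nth_less[OF js(2), of i j] js(1) by simp
      qed
      show "strict_mono_on {..<k} (\<lambda>v. zero_based \<sigma> (f (q v)))"
        using q iso by (auto simp: strict_mono_on_def)
      show "(\<lambda>v. zero_based \<sigma> (f (q v))) ` {..<k} \<subseteq> {..<n}"
        using q fS Sym_nth(2)[OF \<sigma>] by auto
    qed (use fS js(4) u qp in auto)
    then show "\<exists>f g. square_match n k (zero_based p) u (zero_based \<sigma>) l f g" by blast
  }
  {
    assume "\<exists>f g. square_match n k (zero_based p) u (zero_based \<sigma>) l f g"
    then obtain f g where m: "square_match n k (zero_based p) u (zero_based \<sigma>) l f g" by blast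
    define js where "js = map (\<lambda>i. Suc (f i)) [0..<k]"
    have f: "f i < n" if "i < k" for i using m that by (auto simp: square_match_def)
    have fm: "f i < f j" if "i < j" "j < k" for i j
      using m that by (auto simp: square_match_def strict_mono_on_def)
    have gm: "g v < g w \<longleftrightarrow> v < w" if "v < k" "w < k" for v w
      using m that by (auto simp: square_match_def strict_mono_on_less)
    have "red (map (letter \<sigma>) js) = p"
    proof (rule red_eqI[OF p])
      fix i j assume ij: "i < k" "j < k"
      then show "map (letter \<sigma>) js ! i < map (letter \<sigma>) js ! j \<longleftrightarrow> p ! i < p ! j"
        using m f gm Sym_nth[OF p] Sym_nth(1)[OF \<sigma>]
        by (simp add: js_def letter_def square_match_def)
    qed (simp add: js_def)
    moreover have "sorted_wrt (<) js"
      using fm by (auto simp: js_def sorted_wrt_iff_nth_less)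
    moreover have "js ! u = Suc l" using m u by (simp add: js_def square_match_def)
    moreover have "set js \<subseteq> {1..n}" "length js = k" using f by (auto simp: js_def Suc_le_eq)
    ultimately show "match_at (p, Suc u) \<sigma> (Suc l)"
      unfolding match_at_def letter_def by (intro exI[of _ js]) (auto simp: lp l\<sigma>)
  }
qed

section \<open>Extremal permutations and their number\<close>

text \<open>All match positions lie in a block of \<open>d + 1\<close> positions, so the maximal
  count means that the whole block matches.\<close>

lemma pmp_le_and_extremal_iff:
  assumes kn: "k \<le> n" and p: "p \<in> Sym k" and u: "u < k" and \<sigma>: "\<sigma> \<in> Sym n"
  defines "d \<equiv> n - k" and "h \<equiv> zero_based p u"
  shows "pmp (p, Suc u) \<sigma> \<le> d + 1"
    and "pmp (p, Suc u) \<sigma> = d + 1 \<longleftrightarrow>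
      zero_based \<sigma> ` {u..u + d} = {h..h + d} \<and>
      (\<forall>i<k. i \<noteq> u \<longrightarrow> zero_based \<sigma> (stretch d u i) = stretch d h (zero_based p i))"
proof -
  interpret pattern_in_permutation n k u "zero_based p" "zero_based \<sigma>"
    using kn u Sym_bij_betw p \<sigma> by unfold_locales auto
  let ?M = "{l \<in> {u..u + d}. \<exists>f g. square_match n k (zero_based p) u (zero_based \<sigma>) l f g}"
  have "{l \<in> {1..n}. match_at (p, Suc u) \<sigma> l} = Suc ` ?M"
  proof (intro equalityI subsetI)
    fix l assume "l \<in> {l \<in> {1..n}. match_at (p, Suc u) \<sigma> l}"
    then obtain l' where "l = Suc l'" "match_at (p, Suc u) \<sigma> (Suc l')" by (cases l) auto
    then show "l \<in> Suc ` ?M"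
      using match_at_iff_square_match[OF p u \<sigma>] square_match_bounds(1) unfolding d_def by blast
  next
    fix l assume "l \<in> Suc ` ?M"
    then show "l \<in> {l \<in> {1..n}. match_at (p, Suc u) \<sigma> l}"
      using match_at_iff_square_match[OF p u \<sigma>] u kn by (auto simp: d_def)
  qed
  then have pmp: "pmp (p, Suc u) \<sigma> = card ?M"
    using Sym_length[OF \<sigma>] by (simp add: pmp_def card_image)
  have "?M \<subseteq> {u..u + d}" by blast
  then have "card ?M \<le> card {u..u + d}" by (intro card_mono) auto
  then show "pmp (p, Suc u) \<sigma> \<le> d + 1" using pmp by simp
  have "card ?M = d + 1 \<longleftrightarrow> ?M = {u..u + d}"
    using card_subset_eq[OF _ \<open>?M \<subseteq> {u..u + d}\<close>] by fastforce
  also have "\<dots> \<longleftrightarrow> (\<forall>l\<in>{u..u + d}. \<exists>f g. square_match n k (zero_based p) u (zero_based \<sigma>) l f g)"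
    by blast
  finally show "pmp (p, Suc u) \<sigma> = d + 1 \<longleftrightarrow>
      zero_based \<sigma> ` {u..u + d} = {h..h + d} \<and>
      (\<forall>i<k. i \<noteq> u \<longrightarrow> zero_based \<sigma> (stretch d u i) = stretch d h (zero_based p i))"
    using all_match_iff pmp unfolding d_def h_def by simp
qed

text \<open>These permutations correspond to the orderings \<open>m\<close> of the
  \<open>d + 1\<close> middle letters: \<open>w m\<close> inserts \<open>m\<close> in place of the
  marked letter of the stretched pattern.\<close>

lemma card_stretched_permutations:
  assumes kn: "k \<le> n" and p: "p \<in> Sym k" and u: "u < k"
  defines "d \<equiv> n - k" and "h \<equiv> zero_based p u"
  shows "card {\<sigma> \<in> Sym n. zero_based \<sigma> ` {u..u + d} = {h..h + d} \<and>
      (\<forall>i<k. i \<noteq> u \<longrightarrow> zero_based \<sigma> (stretch d u i) = stretch d h (zero_based p i))} = fact (d + 1)"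
    (is "card ?S = _")
proof -
  \<comment> \<open>For \<open>i\<close> other than \<open>u\<close> this is the prescribed letter,
    counted from 1.\<close>
  define c where "c i = Suc (stretch d h (zero_based p i))" for i
  define w where "w m = map c [0..<u] @ m @ map c [Suc u..<k]" for m
  let ?M = "permutations_of_set {Suc h..Suc (h + d)}"
  have hk: "h < k" using Sym_nth(2)[OF p u] by (simp add: h_def)
  have lenM: "length m = Suc d" if "m \<in> ?M" for m
    using that by (simp add: permutations_of_set_def distinct_card[symmetric])
  have nth_w: "w m ! stretch d u i = c i" if "m \<in> ?M" "i < k" "i \<noteq> u" for m i
    using that lenM[OF that(1)] by (auto simp: w_def nth_append stretch_def)
  have nth_mid: "w m ! (u + j) = m ! j" if "m \<in> ?M" "j \<le> d" for m j
    using that lenM[OF that(1)] by (auto simp: w_def nth_append)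
  \<comment> \<open>The prescribed letters are exactly those outside the middle block, so any
    ordering of the middle letters completes them to a permutation.\<close>
  have cS: "c ` ({..<k} - {u}) = {1..h} \<union> {Suc (Suc (h + d))..n}"
  proof -
    have "zero_based p ` ({..<k} - {u}) = {..<k} - {h}"
      using Sym_bij_betw[OF p] u by (auto simp: bij_betw_def h_def inj_on_image_set_diff[where C = "{..<k}"])
    then have "c ` ({..<k} - {u}) = (Suc \<circ> stretch d h) ` ({..<k} - {h})"
      unfolding c_def by (metis (no_types, lifting) comp_apply image_cong image_image)
    also have "\<dots> = {1..h} \<union> {Suc (Suc (h + d))..n}"
    proof (intro equalityI subsetI)
      fix x assume "x \<in> {1..h} \<union> {Suc (Suc (h + d))..n}"
      then show "x \<in> (Suc \<circ> stretch d h) ` ({..<k} - {h})"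
        using hk kn by (intro image_eqI[of _ _ "if x \<le> h then x - 1 else x - 1 - d"])
          (auto simp: stretch_def d_def)
    qed (use hk kn in \<open>auto simp: stretch_def d_def split: if_splits\<close>)
    finally show ?thesis .
  qed
  have wS: "w m \<in> Sym n" if m: "m \<in> ?M" for m
  proof -
    have "set (w m) = c ` ({..<k} - {u}) \<union> set m"
    proof -
      have "{0..<u} \<union> {Suc u..<k} = {..<k} - {u}" using u by auto
      then have "c ` ({..<k} - {u}) = c ` {0..<u} \<union> c ` {Suc u..<k}" by (metis image_Un)
      then show ?thesis by (auto simp: w_def)
    qed
    also have "\<dots> = {1..n}"
      using m cS hk kn by (auto simp: permutations_of_set_def d_def)
    finally have "set (w m) = {1..n}" .
    moreover have "length (w m) = n" using lenM[OF m] u kn by (simp add: w_def d_def)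
    ultimately show ?thesis by (simp add: permutations_of_set_def card_distinct)
  qed
  have "?S = w ` ?M"
  proof (intro equalityI subsetI)
    fix \<sigma> assume "\<sigma> \<in> w ` ?M"
    then obtain m where m: "m \<in> ?M" and \<sigma>: "\<sigma> = w m" by blast
    have "zero_based \<sigma> ` {u..u + d} = (\<lambda>j. m ! j - 1) ` {..d}"
    proof -
      have "{u..u + d} = (+) u ` {..d}"
        by (simp add: image_add_atLeastAtMost atMost_atLeast0)
      then show ?thesis
        using nth_mid[OF m] by (auto simp: zero_based_def \<sigma> image_image)
    qed
    also have "\<dots> = (\<lambda>x. x - 1) ` set m"
      using lenM[OF m] by (force simp: set_conv_nth less_Suc_eq_le)
    also have "\<dots> = {h..h + d}"
    proof -
      have "set m = Suc ` {h..h + d}" using m by (simp add: permutations_of_set_def)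
      then show ?thesis by (simp add: image_image del: image_Suc_atLeastAtMost)
    qed
    finally show "\<sigma> \<in> ?S"
      using wS[OF m] nth_w[OF m] by (auto simp: \<sigma> zero_based_def c_def)
  next
    fix \<sigma> assume S: "\<sigma> \<in> ?S"
    then have \<sigma>: "\<sigma> \<in> Sym n" by simp
    have ln: "length \<sigma> = n" using Sym_length[OF \<sigma>] .
    have nth: "\<sigma> ! stretch d u i = c i" if "i < k" "i \<noteq> u" for i
    proof -
      have "stretch d u i < n" using that kn by (auto simp: stretch_def d_def)
      then show ?thesis using S that Sym_nth(1)[OF \<sigma>] by (simp add: c_def)
    qed
    \<comment> \<open>The ordering is recovered by cutting out the positions \<open>u\<close> to
      \<open>u + d\<close>.\<close>
    define m where "m = take (Suc d) (drop u \<sigma>)"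
    have lm: "length m = Suc d" using ln u kn by (simp add: m_def d_def)
    have "set m = (\<lambda>j. \<sigma> ! j) ` {u..u + d}"
    proof -
      have "{u..u + d} = (+) u ` {..d}"
        by (simp add: image_add_atLeastAtMost atMost_atLeast0)
      moreover have "set m = (\<lambda>j. m ! j) ` {..d}"
        using lm by (auto simp: set_conv_nth less_Suc_eq_le)
      moreover have "m ! j = \<sigma> ! (u + j)" if "j \<le> d" for j
        using that ln u kn by (simp add: m_def d_def)
      ultimately show ?thesis by (simp add: image_image)
    qed
    also have "\<dots> = Suc ` zero_based \<sigma> ` {u..u + d}"
      using Sym_nth(1)[OF \<sigma>] u kn by (auto simp: image_image d_def intro!: image_cong)
    also have "\<dots> = {Suc h..Suc (h + d)}" using S by simp
    finally have "m \<in> ?M"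
      using \<sigma> by (simp add: permutations_of_set_def m_def)
    moreover have "\<sigma> = w m"
    proof (rule nth_equalityI)
      show "length \<sigma> = length (w m)" using lm ln u kn by (simp add: w_def d_def)
      fix j assume "j < length \<sigma>"
      then have j: "j < n" using ln by simp
      consider "j < u" | "j \<in> {u..u + d}" | "u + d < j" by fastforce
      then show "\<sigma> ! j = w m ! j"
      proof cases
        case 1
        then show ?thesis using nth[of j] nth_w[OF \<open>m \<in> ?M\<close>, of j] u by (simp add: stretch_def)
      next
        case 2
        then have "j - u \<le> d" by auto
        with 2 show ?thesis
          using nth_mid[OF \<open>m \<in> ?M\<close>, of "j - u"] j ln by (simp add: m_def)
      next
        case 3
        \<comment> \<open>Beyond the block, subtracting \<open>d\<close> undoes the stretch.\<close>
        then have "j - d < k" "j - d \<noteq> u" "stretch d u (j - d) = j"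
          using j kn by (auto simp: stretch_def d_def)
        then show ?thesis
          using nth[of "j - d"] nth_w[OF \<open>m \<in> ?M\<close>, of "j - d"] by simp
      qed
    qed
    ultimately show "\<sigma> \<in> w ` ?M" by blast
  qed
  moreover have "inj_on w ?M" by (auto simp: inj_on_def w_def)
  ultimately show ?thesis by (simp add: card_image)
qed

section \<open>Degree and leading coefficient\<close>

lemma coeff_P: "coeff (P n \<tau>) m = int (card {\<sigma> \<in> Sym n. pmp \<tau> \<sigma> = m})"
  by (simp add: P_def coeff_sum flip: sum.inter_filter)

theorem theorem5:
  fixes n k :: nat and \<tau> :: marked_pattern
  assumes "0 < n" and "0 < k" and "k \<le> n"
    and "is_marked_pattern k \<tau>"
  shows "degree (P n \<tau>) = n - k + 1 \<and> coeff (P n \<tau>) (n - k + 1) = fact (n - k + 1)"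
proof -
  obtain p u where \<tau>: "\<tau> = (p, Suc u)" and p: "p \<in> Sym k" and u: "u < k"
    using assms(4) unfolding is_marked_pattern_def
    by (metis Suc_le_eq Suc_pred atLeastAtMost_iff less_eq_Suc_le One_nat_def prod.collapse)
  note pmp = pmp_le_and_extremal_iff[OF assms(3) p u]
  have lead: "coeff (P n \<tau>) (n - k + 1) = fact (n - k + 1)"
  proof -
    have "card {\<sigma> \<in> Sym n. pmp \<tau> \<sigma> = n - k + 1} = fact (n - k + 1)"
      using card_stretched_permutations[OF assms(3) p u] pmp(2) \<tau>
      by (simp cong: conj_cong)
    then show ?thesis unfolding coeff_P by (simp only: of_nat_fact)
  qed
  have "degree (P n \<tau>) \<le> n - k + 1"
  proof (rule degree_le, intro allI impI)
    fix m assume "n - k + 1 < m"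
    then have "{\<sigma> \<in> Sym n. pmp \<tau> \<sigma> = m} = {}" using pmp(1) \<tau> by fastforce
    then show "coeff (P n \<tau>) m = 0" unfolding coeff_P by simp
  qed
  \<comment> \<open>A factorial is a nonzero integer, so this coefficient bounds the degree from
    below.\<close>
  moreover have "n - k + 1 \<le> degree (P n \<tau>)"
    using lead by (intro le_degree) simp
  ultimately show ?thesis using lead by simp
qed

end
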